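(* Let $l\ge 1$ and $n>l$ be integers, let $(k_1,k_2)$ be a pair of non-negative integers with $k_1+k_2\le n$ and $(k_1,k_2)\notin\{(0,n),(n,0)\}$, and let $t(X)=s(X)\in Eq(n)$ be a $(k_1,k_2)$-equation. Then the number $\mathrm{Irr}(k_1,k_2,n,l)$ of irreducible components of the solution set $\mathrm{V}(t(X)=s(X))\subseteq L_l^n$ equals \[ \mathrm{Irr}(k_1,k_2,n,l)=\genfrac{\{}{\}}{0pt}{}{n}{l}^{\ast}-\sum_{i=1}^{k_1}\binom{k_1}{i}\genfrac{\{}{\}}{0pt}{}{n-i}{l-1}^{\ast}-\sum_{i=1}^{k_2}\binom{k_2}{i}\genfrac{\{}{\}}{0pt}{}{n-i}{l-1}^{\ast}. \]
   Context: $L_l=\{a_1,\dots,a_l\}$ with $a_1<a_2<\dots<a_l$ is the linearly ordered semilattice of $l$ elements, with multiplication $a_i\cdot a_j=a_{\min(i,j)}$. A term in the variables $X=\{x_1,\dots,x_n\}$ is a (non-empty) commutative word in the letters $x_i$ (no constants); $\mathrm{Var}(t)$ is the set of variables occurring in $t$. An equation is an equality of terms $t(X)=s(X)$. $Eq(n)$ is the set of equations $t(X)=s(X)$ such that every variable $x_1,\dots,x_n$ occurs in $t$ or in $s$. An equation $t(X)=s(X)\in Eq(n)$ is a $(k_1,k_2)$-equation if $|\mathrm{Var}(t)\setminus\mathrm{Var}(s)|=k_1$ and $|\mathrm{Var}(s)\setminus\mathrm{Var}(t)|=k_2$. A point $P\in L_l^n$ is a solution of $t(X)=s(X)$ if $t(P)=s(P)$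 in $L_l$. A system is an arbitrary set of equations, and $\mathrm{V}(\mathbf{S})\subseteq L_l^n$ is the set of common solutions of a system $\mathbf{S}$ in $n$ variables. A set is algebraic over $L_l$ if it equals $\mathrm{V}(\mathbf S)$ for some system $\mathbf S$ in $n$ variables. An algebraic set is irreducible if it is not a proper finite union of other algebraic sets. The irreducible components of an algebraic set $Y$ are the sets in its unique decomposition $Y=Y_1\cup\dots\cup Y_m$ into irreducible algebraic sets with $Y_i\nsubseteq Y_j$ for $i\neq j$. $\genfrac{\{}{\}}{0pt}{}{n}{m}$ denotes the Stirling number of the second kind (the number of partitions of an $n$-element set into $m$ non-empty unlabelled subsets; in particular it is $1$ for $n=m=0$ and $0$ for $n<m$), and $\genfrac{\{}{\}}{0pt}{}{n}{m}^{\ast}=m!\genfrac{\{}{\}}{0pt}{}{n}{m}$. *)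

theory Defs
  imports "HOL-Library.Multiset" "HOL-Library.FuncSet" "HOL-Combinatorics.Stirling"
begin

text \<open>The element \<open>a\<^sub>i\<close> of the linearly ordered semilattice \<open>L\<^sub>l\<close> is represented by the
  number \<open>i\<close>, and the variable \<open>x\<^sub>i\<close> by its index \<open>i\<close>.\<close>

definition L :: "nat \<Rightarrow> nat set" where
  "L l = {1..l}"

definition points :: "nat \<Rightarrow> nat \<Rightarrow> (nat \<Rightarrow> nat) set" where
  "points l n = {1..n} \<rightarrow>\<^sub>E L l"

type_synonym trm = "nat multiset"
type_synonym eqn = "trm \<times> trm"

definition is_term :: "nat \<Rightarrow> trm \<Rightarrow> bool" where
  "is_term n t \<longleftrightarrow> t \<noteq> {#} \<and> set_mset t \<subseteq> {1..n}"

definition equations :: "nat \<Rightarrow> eqn set" where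
  "equations n = {(t, s). is_term n t \<and> is_term n s}"

definition Eq :: "nat \<Rightarrow> eqn set" where
  "Eq n = {(t, s). (t, s) \<in> equations n \<and> set_mset t \<union> set_mset s = {1..n}}"

definition is_k_equation :: "nat \<Rightarrow> nat \<Rightarrow> eqn \<Rightarrow> bool" where
  "is_k_equation k1 k2 e \<longleftrightarrow>
     card (set_mset (fst e) - set_mset (snd e)) = k1 \<and>
     card (set_mset (snd e) - set_mset (fst e)) = k2"

text \<open>The value of a word is the product of the values of its letters. Multiplication is \<open>min\<close>,
  which is idempotent, so \<open>Min\<close> over the set of values is this product; see
  \<open>value_single\<close> and \<open>value_mult\<close>.\<close>

definition value_at :: "(nat \<Rightarrow> nat) \<Rightarrow> trm \<Rightarrow> nat" where
  "value_at P t = Min (P ` set_mset t)"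

lemma value_single: "value_at P {#i#} = P i"
  by (simp add: value_at_def)

lemma value_mult:
  assumes "t \<noteq> {#}" "s \<noteq> {#}"
  shows "value_at P (t + s) = min (value_at P t) (value_at P s)"
  using assms by (simp add: value_at_def image_Un Min_Un)

definition V :: "nat \<Rightarrow> nat \<Rightarrow> eqn set \<Rightarrow> (nat \<Rightarrow> nat) set" where
  "V l n S = {P \<in> points l n. \<forall>(t, s) \<in> S. value_at P t = value_at P s}"

definition algebraic :: "nat \<Rightarrow> nat \<Rightarrow> (nat \<Rightarrow> nat) set \<Rightarrow> bool" where
  "algebraic l n Y \<longleftrightarrow> (\<exists>S \<subseteq> equations n. Y = V l n S)"

definition irreducible_set :: "nat \<Rightarrow> nat \<Rightarrow> (nat \<Rightarrow> nat) set \<Rightarrow> bool" where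
  "irreducible_set l n Y \<longleftrightarrow> algebraic l n Y \<and>
     \<not> (\<exists>F. finite F \<and> (\<forall>Z \<in> F. algebraic l n Z \<and> Z \<noteq> Y) \<and> Y = \<Union>F)"

definition is_decomposition ::
  "nat \<Rightarrow> nat \<Rightarrow> (nat \<Rightarrow> nat) set \<Rightarrow> (nat \<Rightarrow> nat) set set \<Rightarrow> bool" where
  "is_decomposition l n Y C \<longleftrightarrow> finite C \<and> (\<forall>Z \<in> C. irreducible_set l n Z) \<and> Y = \<Union>C \<and>
     (\<forall>Z \<in> C. \<forall>W \<in> C. Z \<noteq> W \<longrightarrow> \<not> Z \<subseteq> W)"

definition irreducible_components ::
  "nat \<Rightarrow> nat \<Rightarrow> (nat \<Rightarrow> nat) set \<Rightarrow> (nat \<Rightarrow> nat) set set" where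
  "irreducible_components l n Y = (THE C. is_decomposition l n Y C)"

definition Stirling_star :: "nat \<Rightarrow> nat \<Rightarrow> nat" where
  "Stirling_star n m = fact m * Stirling n m"

text \<open>The decomposition is unique, so \<open>irreducible_components\<close> is well defined.\<close>

lemma finite_algebraic: "algebraic l n Y \<Longrightarrow> finite Y"
proof (rule finite_subset)
  show "finite (points l n)" unfolding points_def L_def by (intro finite_PiE) simp_all
qed (auto simp: algebraic_def V_def)

lemma algebraic_Int:
  assumes "algebraic l n Y" "algebraic l n Z"
  shows "algebraic l n (Y \<inter> Z)"
proof -
  obtain S T where "S \<subseteq> equations n" "T \<subseteq> equations n" "Y = V l n S" "Z = V l n T"
    using assms unfolding algebraic_def by blast
  moreover have "V l n S \<inter> V l n T = V l n (S \<union> T)"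
    unfolding V_def by auto
  ultimately show ?thesis
    unfolding algebraic_def by (metis Un_subset_iff)
qed

lemma union_of_irreducibles:
  assumes "algebraic l n Y"
  shows "\<exists>C. finite C \<and> (\<forall>Z \<in> C. irreducible_set l n Z) \<and> Y = \<Union>C"
  using assms
proof (induction "card Y" arbitrary: Y rule: less_induct)
  case less
  show ?case
  proof (cases "irreducible_set l n Y")
    case True
    then show ?thesis by (intro exI[of _ "{Y}"]) auto
  next
    case False
    then obtain F where F: "finite F" "\<forall>Z \<in> F. algebraic l n Z \<and> Z \<noteq> Y" "Y = \<Union>F"
      using less.prems unfolding irreducible_set_def by blast
    have "\<exists>C. finite C \<and> (\<forall>W \<in> C. irreducible_set l n W) \<and> Z = \<Union>C" if "Z \<in> F" for Z
    proof -
      have "Z \<subset> Y" using F that by blast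
      then have "card Z < card Y"
        using finite_algebraic[OF less.prems] by (simp add: psubset_card_mono)
      then show ?thesis using less.hyps F(2) that by blast
    qed
    then obtain c where c: "\<And>Z. Z \<in> F \<Longrightarrow>
        finite (c Z) \<and> (\<forall>W \<in> c Z. irreducible_set l n W) \<and> Z = \<Union>(c Z)"
      by metis
    have "\<Union>F = (\<Union>Z\<in>F. \<Union>(c Z))" using c by (metis (no_types, lifting) SUP_cong image_ident)
    then have "Y = \<Union>(\<Union>(c ` F))" using F(3) by auto
    then show ?thesis
      using F(1) c by (intro exI[of _ "\<Union>(c ` F)"]) auto
  qed
qed

lemma irreducible_subset_Union:
  assumes "irreducible_set l n Z" "finite C" "\<forall>W \<in> C. algebraic l n W" "Z \<subseteq> \<Union>C"
  shows "\<exists>W \<in> C. Z \<subseteq> W"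
proof (rule ccontr)
  assume neg: "\<not> (\<exists>W \<in> C. Z \<subseteq> W)"
  let ?F = "(\<lambda>W. Z \<inter> W) ` C"
  have Z: "algebraic l n Z" using assms(1) unfolding irreducible_set_def by simp
  have "finite ?F" using assms(2) by simp
  moreover have "algebraic l n X \<and> X \<noteq> Z" if "X \<in> ?F" for X
  proof -
    obtain W where W: "W \<in> C" "X = Z \<inter> W" using \<open>X \<in> ?F\<close> by (elim imageE)
    have "algebraic l n X" using W assms(3) algebraic_Int[OF Z] by simp
    moreover have "X \<noteq> Z" using W neg by (metis Int_lower2)
    ultimately show ?thesis by simp
  qed
  moreover have "Z = \<Union>?F" using assms(4) by auto
  ultimately show False using assms(1) unfolding irreducible_set_def by metis
qed

lemma decomposition_subset:
  assumes C: "is_decomposition l n Y C" and D: "is_decomposition l n Y D"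
  shows "C \<subseteq> D"
proof
  fix Z assume Z: "Z \<in> C"
  have step: "\<exists>W \<in> B. X \<subseteq> W"
    if "is_decomposition l n Y A" "is_decomposition l n Y B" "X \<in> A" for A B X
    by (rule irreducible_subset_Union[of l n])
       (use that in \<open>auto simp: is_decomposition_def irreducible_set_def\<close>)
  obtain W where W: "W \<in> D" "Z \<subseteq> W" using step[OF C D Z] by blast
  obtain X where X: "X \<in> C" "W \<subseteq> X" using step[OF D C W(1)] by blast
  have "Z = X" using C Z X W unfolding is_decomposition_def by (meson subset_trans)
  then show "Z \<in> D" using W X by auto
qed

lemma decomposition_ex1:
  assumes "algebraic l n Y"
  shows "\<exists>!C. is_decomposition l n Y C"
proof -
  obtain C where C: "finite C" "\<forall>Z \<in> C. irreducible_set l n Z" "Y = \<Union>C"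
    using union_of_irreducibles[OF assms] by blast
  let ?M = "{Z \<in> C. \<forall>W \<in> C. Z \<subseteq> W \<longrightarrow> Z = W}"
  have "\<exists>W \<in> ?M. Z \<subseteq> W" if "Z \<in> C" for Z
    using finite_has_maximal2[OF C(1) that] by blast
  then have "\<Union>?M = \<Union>C" by blast
  then have M: "is_decomposition l n Y ?M"
    using C unfolding is_decomposition_def by auto
  show ?thesis
  proof (rule ex1I[where a = ?M])
    show "is_decomposition l n Y ?M" by (fact M)
  next
    fix D assume D: "is_decomposition l n Y D"
    show "D = ?M"
      using decomposition_subset[OF D M] decomposition_subset[OF M D] by (rule subset_antisym)
  qed
qed

lemma irreducible_components_decomposition:
  assumes "algebraic l n Y"
  shows "is_decomposition l n Y (irreducible_components l n Y)"
  unfolding irreducible_components_def by (rule theI'[OF decomposition_ex1[OF assms]])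

end

theory Submission
  imports Defs
begin

text \<open>
  The closure of a point \<open>P\<close>, i.e. the least algebraic set containing it, consists of the points
  that respect the preorder \<open>P i \<le> P j\<close> on the variables. Hence the irreducible algebraic sets
  are the closures of points. A point \<open>P\<close> solves the equation iff the variables on which \<open>P\<close> is minimal
  meet both sides. As long as a solution takes fewer than \<open>l < n\<close> values, one variable can be
  moved just above the others of equal value so that the result still is a solution; so every
  solution lies in the closure of a surjective one. Surjective points lie in no closure but their own,
  and so the components correspond to the surjective solutions. A surjective point is not a solution
  iff the set on which it takes the value \<open>1\<close> lies inside one of the two differences of the variable
  sets, and these points are counted by the size of that set.
\<close>

section \<open>Counting surjections\<close>

text \<open>Extensional functions, so that each surjection is counted once; for
  \<open>A = {1..n}\<close> and \<open>B = L l\<close> they are the surjective elements of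
  \<open>points l n\<close>.\<close>

definition surjections :: "'a set \<Rightarrow> 'b set \<Rightarrow> ('a \<Rightarrow> 'b) set" where
  "surjections A B = {f \<in> A \<rightarrow>\<^sub>E B. f ` A = B}"

lemma finite_surjections: "finite A \<Longrightarrow> finite B \<Longrightarrow> finite (surjections A B)"
  unfolding surjections_def by (simp add: finite_PiE)

text \<open>The recurrence for \<open>Stirling\<close>, multiplied by \<open>fact m\<close>. At
  \<open>m = 0\<close> both sides vanish, so the truncated \<open>m - 1\<close> does no
  harm.\<close>

lemma Stirling_star_Suc:
  "Stirling_star (Suc n) m = m * (Stirling_star n m + Stirling_star n (m - 1))"
  by (cases m) (simp_all add: Stirling_star_def algebra_simps)

text \<open>The restriction to \<open>A\<close> maps onto \<open>B\<close> or onto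
  \<open>B - {b}\<close>, depending on whether the value \<open>b\<close> at \<open>a\<close> is
  taken again on \<open>A\<close>.\<close>

lemma bij_betw_surjections_insert:
  assumes "a \<notin> A"
  shows "bij_betw (\<lambda>f. (f a, restrict f A)) (surjections (insert a A) B)
    (SIGMA b:B. surjections A B \<union> surjections A (B - {b}))"
proof (rule bij_betwI[where g = "\<lambda>(b, g). g(a := b)"])
  show "(\<lambda>f. (f a, restrict f A)) \<in> surjections (insert a A) B \<rightarrow>
      (SIGMA b:B. surjections A B \<union> surjections A (B - {b}))"
  proof
    fix f assume f: "f \<in> surjections (insert a A) B"
    then have "insert (f a) (f ` A) = B" by (auto simp: surjections_def)
    then have "f a \<in> B" "f ` A = B \<or> f ` A = B - {f a}" by blast+
    then show "(f a, restrict f A) \<in> (SIGMA b:B. surjections A B \<union> surjections A (B - {b}))"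
      by (auto simp: surjections_def)
  qed
  show "(\<lambda>(b, g). g(a := b)) \<in> (SIGMA b:B. surjections A B \<union> surjections A (B - {b})) \<rightarrow>
      surjections (insert a A) B"
  proof (clarify)
    fix b g assume b: "b \<in> B" and g: "g \<in> surjections A B \<union> surjections A (B - {b})"
    have "(g(a := b)) ` insert a A = insert b (g ` A)" using assms by auto
    also have "\<dots> = B" using b g by (auto simp: surjections_def)
    finally have "(g(a := b)) ` insert a A = B" .
    moreover have "g \<in> A \<rightarrow>\<^sub>E B" using g by (auto simp: surjections_def)
    then have "g(a := b) \<in> insert a A \<rightarrow>\<^sub>E B" using b by (auto simp: PiE_def extensional_def)
    ultimately show "g(a := b) \<in> surjections (insert a A) B"
      unfolding surjections_def by blast
  qed
  show "(case (f a, restrict f A) of (b, g) \<Rightarrow> g(a := b)) = f"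
    if "f \<in> surjections (insert a A) B" for f
    using that by (auto simp: surjections_def fun_eq_iff PiE_def extensional_def)
  show "((case p of (b, g) \<Rightarrow> g(a := b)) a, restrict (case p of (b, g) \<Rightarrow> g(a := b)) A) = p"
    if "p \<in> (SIGMA b:B. surjections A B \<union> surjections A (B - {b}))" for p
    using that assms by (auto simp: surjections_def fun_eq_iff PiE_def extensional_def)
qed

text \<open>Splitting off one point gives the recurrence of \<open>Stirling_star\<close>. The
  codomain varies in the induction because it may shrink to \<open>B - {b}\<close>.\<close>

lemma card_surjections:
  fixes A :: "'a set" and B :: "'b set"
  assumes "finite A" "finite B"
  shows "card (surjections A B) = Stirling_star (card A) (card B)"
  using assms
proof (induction A arbitrary: B rule: finite_induct)
  case empty
  have "(surjections {} B :: ('a \<Rightarrow> 'b) set) = (if B = {} then {\<lambda>x. undefined} else {})"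
    by (auto simp: surjections_def)
  then show ?case
    using empty by (cases "card B") (auto simp: Stirling_star_def)
next
  case (insert a A)
  let ?S = "\<lambda>b. surjections A B \<union> surjections A (B - {b})"
  have "card (surjections (insert a A) B) = card (SIGMA b:B. ?S b)"
    using bij_betw_same_card[OF bij_betw_surjections_insert[OF insert.hyps(2)]] .
  also have "\<dots> = (\<Sum>b\<in>B. card (?S b))"
    using insert.hyps(1) insert.prems by (simp add: card_SigmaI finite_surjections)
  also have "\<dots> = (\<Sum>b\<in>B. Stirling_star (card A) (card B) + Stirling_star (card A) (card B - 1))"
  proof (intro sum.cong refl)
    fix b assume b: "b \<in> B"
    then have "surjections A B \<inter> surjections A (B - {b}) = {}"
      by (auto simp: surjections_def)
    then show "card (?S b) = Stirling_star (card A) (card B) + Stirling_star (card A) (card B - 1)"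
      using insert b by (simp add: card_Un_disjoint finite_surjections)
  qed
  also have "\<dots> = Stirling_star (card (insert a A)) (card B)"
    using insert.hyps by (simp add: Stirling_star_Suc)
  finally show ?case .
qed

text \<open>On the fibre \<open>I\<close> the function is constantly \<open>b\<close>, so forgetting
  \<open>I\<close> loses nothing; conversely, filling the non-empty \<open>I\<close> with
  \<open>b\<close> makes \<open>b\<close> a value.\<close>

lemma bij_betw_surjections_fibre:
  assumes "I \<subseteq> A" "I \<noteq> {}" "b \<in> B"
  shows "bij_betw (\<lambda>f. restrict f (A - I)) {f \<in> surjections A B. {x \<in> A. f x = b} = I}
    (surjections (A - I) (B - {b}))"
proof (rule bij_betwI[where g = "\<lambda>g x. if x \<in> I then b else g x"])
  show "(\<lambda>f. restrict f (A - I)) \<in> {f \<in> surjections A B. {x \<in> A. f x = b} = I} \<rightarrow>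
      surjections (A - I) (B - {b})"
  proof
    fix f assume "f \<in> {f \<in> surjections A B. {x \<in> A. f x = b} = I}"
    then have "f ` A = B" "{x \<in> A. f x = b} = I" by (auto simp: surjections_def)
    then have "f ` (A - I) = B - {b}" by auto
    then show "restrict f (A - I) \<in> surjections (A - I) (B - {b})"
      by (auto simp: surjections_def)
  qed
  show "(\<lambda>g x. if x \<in> I then b else g x) \<in> surjections (A - I) (B - {b}) \<rightarrow>
      {f \<in> surjections A B. {x \<in> A. f x = b} = I}"
  proof
    fix g assume g: "g \<in> surjections (A - I) (B - {b})"
    let ?f = "\<lambda>x. if x \<in> I then b else g x"
    have "?f ` A = ?f ` I \<union> ?f ` (A - I)" using assms(1) by blast
    also have "\<dots> = {b} \<union> g ` (A - I)" using assms(2) by auto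
    also have "\<dots> = B" using g assms(3) by (auto simp: surjections_def)
    finally have "?f ` A = B" .
    moreover have "?f \<in> A \<rightarrow>\<^sub>E B" "{x \<in> A. ?f x = b} = I"
      using g assms by (auto simp: surjections_def PiE_def extensional_def Pi_def)
    ultimately show "?f \<in> {f \<in> surjections A B. {x \<in> A. f x = b} = I}"
      by (simp add: surjections_def)
  qed
  show "(\<lambda>x. if x \<in> I then b else restrict f (A - I) x) = f"
    if "f \<in> {f \<in> surjections A B. {x \<in> A. f x = b} = I}" for f
    using that by (auto simp: surjections_def fun_eq_iff PiE_def extensional_def)
  show "restrict (\<lambda>x. if x \<in> I then b else g x) (A - I) = g"
    if "g \<in> surjections (A - I) (B - {b})" for g
    using that by (auto simp: surjections_def fun_eq_iff PiE_def extensional_def)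
qed

text \<open>The subsets are grouped by size; the sum starts at 1 because the empty set is left
  out.\<close>

lemma sum_nonempty_subsets_card:
  fixes g :: "nat \<Rightarrow> nat"
  assumes "finite D"
  shows "(\<Sum>I\<in>Pow D - {{}}. g (card I)) = (\<Sum>i=1..card D. (card D choose i) * g i)"
proof -
  have "card ` (Pow D - {{}}) \<subseteq> {1..card D}"
  proof
    fix i assume "i \<in> card ` (Pow D - {{}})"
    then obtain I where I: "I \<subseteq> D" "I \<noteq> {}" "i = card I" by auto
    moreover have "finite I" using I assms finite_subset by blast
    ultimately show "i \<in> {1..card D}"
      using assms by (simp add: card_mono Suc_le_eq card_gt_0_iff)
  qed
  then have "(\<Sum>I\<in>Pow D - {{}}. g (card I)) =
      (\<Sum>i=1..card D. \<Sum>I\<in>{I \<in> Pow D - {{}}. card I = i}. g (card I))"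
    using assms by (subst sum.group) auto
  also have "\<dots> = (\<Sum>i=1..card D. (card D choose i) * g i)"
  proof (intro sum.cong refl)
    fix i assume "i \<in> {1..card D}"
    then have "{I \<in> Pow D - {{}}. card I = i} = {I. I \<subseteq> D \<and> card I = i}" by auto
    then show "(\<Sum>I\<in>{I \<in> Pow D - {{}}. card I = i}. g (card I)) = (card D choose i) * g i"
      using n_subsets[OF assms, of i] by simp
  qed
  finally show ?thesis .
qed

text \<open>Surjections are classified by their exact fibre \<open>I\<close> over \<open>b\<close>,
  which is non-empty because \<open>b\<close> is attained; what remains is a surjection from
  \<open>A - I\<close> onto \<open>B - {b}\<close>.\<close>

lemma card_surjections_fibre_subset:
  assumes "finite A" "finite B" "b \<in> B" "D \<subseteq> A"
  shows "card {f \<in> surjections A B. {x \<in> A. f x = b} \<subseteq> D} =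
    (\<Sum>i=1..card D. (card D choose i) * Stirling_star (card A - i) (card B - 1))"
proof -
  have D: "finite D" using assms(1,4) finite_subset by blast
  let ?F = "\<lambda>I. {f \<in> surjections A B. {x \<in> A. f x = b} = I}"
  have "{x \<in> A. f x = b} \<noteq> {}" if "f \<in> surjections A B" for f
    using that assms(3) by (auto simp: surjections_def)
  then have "{f \<in> surjections A B. {x \<in> A. f x = b} \<subseteq> D} = (\<Union>I\<in>Pow D - {{}}. ?F I)"
    by blast
  then have "card {f \<in> surjections A B. {x \<in> A. f x = b} \<subseteq> D} = card (\<Union>I\<in>Pow D - {{}}. ?F I)"
    by simp
  also have "\<dots> = (\<Sum>I\<in>Pow D - {{}}. card (?F I))"
    using D assms by (intro card_UN_disjoint) (auto simp: finite_surjections)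
  also have "\<dots> = (\<Sum>I\<in>Pow D - {{}}. Stirling_star (card A - card I) (card B - 1))"
  proof (intro sum.cong refl)
    fix I assume "I \<in> Pow D - {{}}"
    then have I: "I \<subseteq> A" "I \<noteq> {}" "finite I" using assms(4) D finite_subset by auto
    show "card (?F I) = Stirling_star (card A - card I) (card B - 1)"
      using bij_betw_same_card[OF bij_betw_surjections_fibre[OF I(1,2) assms(3)]] I assms
      by (simp add: card_surjections card_Diff_subset)
  qed
  also have "\<dots> = (\<Sum>i=1..card D. (card D choose i) * Stirling_star (card A - i) (card B - 1))"
    by (rule sum_nonempty_subsets_card[OF D])
  finally show ?thesis .
qed

section \<open>Closures of points\<close>

definition point_closure :: "nat \<Rightarrow> nat \<Rightarrow> (nat \<Rightarrow> nat) \<Rightarrow> (nat \<Rightarrow> nat) set" where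
  "point_closure l n P =
     {Q \<in> points l n. \<forall>i \<in> {1..n}. \<forall>j \<in> {1..n}. P i \<le> P j \<longrightarrow> Q i \<le> Q j}"

lemma value_at_eqI:
  assumes "x \<in># t" "\<And>y. y \<in># t \<Longrightarrow> P x \<le> P y"
  shows "value_at P t = P x"
  unfolding value_at_def using assms by (intro Min_eqI) auto

lemma value_at_attained:
  assumes "t \<noteq> {#}"
  obtains x where "x \<in># t" "value_at P t = P x" "\<And>y. y \<in># t \<Longrightarrow> P x \<le> P y"
proof -
  have "value_at P t \<in> P ` set_mset t"
    unfolding value_at_def using assms by (intro Min_in) auto
  then obtain x where "x \<in># t" "value_at P t = P x" by auto
  moreover have "value_at P t \<le> P y" if "y \<in># t" for y
    unfolding value_at_def using that by simp
  ultimately show ?thesis using that by metis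
qed

lemma mem_point_closure_self: "P \<in> points l n \<Longrightarrow> P \<in> point_closure l n P"
  by (simp add: point_closure_def)

text \<open>As multiplication is \<open>min\<close>, the condition \<open>Q i \<le> Q j\<close> is
  the equation of the words \<open>{#i#}\<close> and \<open>{#i, j#}\<close>.\<close>

lemma algebraic_point_closure: "algebraic l n (point_closure l n P)"
proof -
  let ?S = "{({#i#}, {#i, j#}) | i j. i \<in> {1..n} \<and> j \<in> {1..n} \<and> P i \<le> P j}"
  have "value_at Q {#i#} = value_at Q {#i, j#} \<longleftrightarrow> Q i \<le> Q j" for Q i j
    by (auto simp: value_at_def min_def)
  then have "point_closure l n P = V l n ?S"
    unfolding point_closure_def V_def by blast
  moreover have "?S \<subseteq> equations n" by (auto simp: equations_def is_term_def)
  ultimately show ?thesis unfolding algebraic_def by blast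
qed

text \<open>If \<open>x\<close> and \<open>y\<close> are letters of \<open>t\<close> and
  \<open>s\<close> that are minimal under \<open>P\<close>, they remain minimal under
  \<open>Q\<close>, and \<open>P x = P y\<close> forces \<open>Q x = Q y\<close>. So every equation
  true at \<open>P\<close> is true at \<open>Q\<close>.\<close>

lemma point_closure_subset:
  assumes "algebraic l n Z" "P \<in> Z"
  shows "point_closure l n P \<subseteq> Z"
proof
  fix Q assume Q: "Q \<in> point_closure l n P"
  obtain S where S: "S \<subseteq> equations n" "Z = V l n S"
    using assms(1) unfolding algebraic_def by blast
  have "value_at Q t = value_at Q s" if "(t, s) \<in> S" for t s
  proof -
    have ts: "is_term n t" "is_term n s" using S(1) that by (auto simp: equations_def)
    obtain x where x: "x \<in># t" "value_at P t = P x" "\<And>y. y \<in># t \<Longrightarrow> P x \<le> P y"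
      using ts(1) value_at_attained unfolding is_term_def by metis
    obtain y where y: "y \<in># s" "value_at P s = P y" "\<And>z. z \<in># s \<Longrightarrow> P y \<le> P z"
      using ts(2) value_at_attained unfolding is_term_def by metis
    have "P x = P y" using that assms(2) S(2) x(2) y(2) unfolding V_def by auto
    have mono: "Q i \<le> Q j" if "i \<in> set_mset t \<union> set_mset s" "j \<in> set_mset t \<union> set_mset s" "P i \<le> P j" for i j
    proof -
      have "i \<in> {1..n}" "j \<in> {1..n}" using that ts unfolding is_term_def by blast+
      then show ?thesis using Q that(3) unfolding point_closure_def by blast
    qed
    have "value_at Q t = Q x" using x mono by (intro value_at_eqI) auto
    also have "\<dots> = Q y" using x(1) y(1) \<open>P x = P y\<close> by (intro antisym mono) auto
    also have "\<dots> = value_at Q s" using y mono by (intro value_at_eqI[symmetric]) auto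
    finally show ?thesis .
  qed
  then show "Q \<in> Z" using Q S(2) unfolding V_def point_closure_def by auto
qed

text \<open>In any cover by algebraic sets, the member that contains \<open>P\<close> already
  contains the whole closure.\<close>

lemma irreducible_point_closure:
  assumes "P \<in> points l n"
  shows "irreducible_set l n (point_closure l n P)"
  unfolding irreducible_set_def
proof (intro conjI notI)
  show "algebraic l n (point_closure l n P)" by (rule algebraic_point_closure)
next
  assume "\<exists>F. finite F \<and> (\<forall>Z\<in>F. algebraic l n Z \<and> Z \<noteq> point_closure l n P) \<and>
    point_closure l n P = \<Union>F"
  then obtain F where F: "\<forall>Z\<in>F. algebraic l n Z \<and> Z \<noteq> point_closure l n P"
    "point_closure l n P = \<Union>F" by blast
  then obtain Z where Z: "Z \<in> F" "P \<in> Z" using mem_point_closure_self[OF assms] by (metis UnionE)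
  have "point_closure l n P \<subseteq> Z" using F(1) Z point_closure_subset by simp
  moreover have "Z \<subseteq> point_closure l n P" using F(2) Z(1) by (metis Union_upper)
  ultimately show False using F(1) Z(1) by (metis subset_antisym)
qed

text \<open>Strict inequalities of \<open>P\<close> carry over to \<open>P'\<close>. As
  \<open>P\<close> takes all of \<open>1..l\<close>, every variable lies on a strict chain of full
  length \<open>l\<close>, and \<open>P'\<close> has only \<open>l\<close> values to place this
  chain on.\<close>

lemma surjection_mem_point_closure_imp_eq:
  assumes P: "P \<in> surjections {1..n} (L l)" and P': "P' \<in> points l n"
    and mem: "P \<in> point_closure l n P'"
  shows "P' = P"
proof -
  have im: "P ` {1..n} = {1..l}" and PE: "P \<in> {1..n} \<rightarrow>\<^sub>E {1..l}"
    using P unfolding surjections_def L_def by auto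
  have PE': "P' \<in> {1..n} \<rightarrow>\<^sub>E {1..l}" using P' unfolding points_def L_def .
  have strict: "P' i < P' j" if "i \<in> {1..n}" "j \<in> {1..n}" "P i < P j" for i j
  proof (rule ccontr)
    assume "\<not> P' i < P' j"
    then have "P j \<le> P i" using mem that(1,2) unfolding point_closure_def by simp
    then show False using that(3) by simp
  qed
  have lower: "v \<le> P' i" if "i \<in> {1..n}" "P i = v" for v i
    using that
  proof (induction v arbitrary: i)
    case (Suc v)
    show ?case
    proof (cases "v = 0")
      case True
      then show ?thesis using PiE_mem[OF PE' Suc.prems(1)] by simp
    next
      case False
      have "Suc v \<in> {1..l}" using PiE_mem[OF PE Suc.prems(1)] Suc.prems(2) by simp
      then have "v \<in> P ` {1..n}" using False im by simp
      then obtain j where j: "j \<in> {1..n}" "P j = v" by auto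
      then have "P' j < P' i" using Suc.prems strict by simp
      then show ?thesis using Suc.IH[OF j] by simp
    qed
  qed simp
  \<comment> \<open>Measuring the distance \<open>d\<close> from the top turns the downward
    induction into an upward one; it is used with \<open>d = l - P i\<close>.\<close>
  have upper: "P' i \<le> l - d" if "i \<in> {1..n}" "P i = l - d" for d i
    using that
  proof (induction d arbitrary: i)
    case 0
    then show ?case using PiE_mem[OF PE' 0(1)] by simp
  next
    case (Suc d)
    have "1 \<le> l - Suc d" using PiE_mem[OF PE Suc.prems(1)] Suc.prems(2) by simp
    then have "l - d \<in> P ` {1..n}" using im by simp
    then obtain j where j: "j \<in> {1..n}" "P j = l - d" by auto
    then have "P' i < P' j" using Suc.prems \<open>1 \<le> l - Suc d\<close> by (intro strict) auto
    then show ?case using Suc.IH[OF j] by simp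
  qed
  have "P' i = P i" if i: "i \<in> {1..n}" for i
  proof (rule antisym)
    have "P i \<le> l" using PiE_mem[OF PE i] by simp
    then show "P' i \<le> P i" using upper[OF i, of "l - P i"] by simp
    show "P i \<le> P' i" using lower[OF i] by simp
  qed
  then show ?thesis by (intro PiE_ext[OF PE' PE])
qed

section \<open>Refining solutions to surjective ones\<close>

text \<open>The rank of \<open>f i\<close> among the values of \<open>f\<close> serves as
  \<open>g i\<close>. This compresses arbitrary values to an initial segment, so that a refined
  assignment can be brought back into \<open>L l\<close>.\<close>

lemma order_preserving_ranking:
  fixes f :: "'a \<Rightarrow> nat"
  assumes "finite A"
  obtains g where "g \<in> A \<rightarrow>\<^sub>E {1..card (f ` A)}" "g ` A = {1..card (f ` A)}"
    "\<And>i j. i \<in> A \<Longrightarrow> j \<in> A \<Longrightarrow> g i \<le> g j \<longleftrightarrow> f i \<le> f j"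
proof -
  define h where "h v = card {y \<in> f ` A. y \<le> v}" for v
  define g where "g = restrict (h \<circ> f) A"
  have fin: "finite (f ` A)" using assms by simp
  have h_mono: "h v \<le> h w" if "v \<le> w" for v w
    unfolding h_def using that fin by (intro card_mono) auto
  have h_less: "h v < h w" if "v < w" "w \<in> f ` A" for v w
    unfolding h_def
  proof (rule psubset_card_mono)
    show "finite {y \<in> f ` A. y \<le> w}" using fin by simp
    have "w \<in> {y \<in> f ` A. y \<le> w} - {y \<in> f ` A. y \<le> v}" using that by simp
    then show "{y \<in> f ` A. y \<le> v} \<subset> {y \<in> f ` A. y \<le> w}" using that(1) by fastforce
  qed
  have order: "g i \<le> g j \<longleftrightarrow> f i \<le> f j" if "i \<in> A" "j \<in> A" for i j
    using that h_mono[of "f i" "f j"] h_less[of "f j" "f i"] by (force simp: g_def)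
  have range: "g i \<in> {1..card (f ` A)}" if "i \<in> A" for i
  proof -
    have "f i \<in> {y \<in> f ` A. y \<le> f i}" using that by simp
    then have "0 < h (f i)" unfolding h_def using fin by (subst card_gt_0_iff) auto
    moreover have "h (f i) \<le> card (f ` A)" unfolding h_def using fin by (intro card_mono) auto
    ultimately show ?thesis using that by (simp add: g_def)
  qed
  \<comment> \<open>Ranking is strictly monotone on the values of \<open>f\<close>, so
    \<open>g\<close> has as many values as \<open>f\<close> and fills the interval that contains
    them.\<close>
  have "inj_on h (f ` A)" using h_less by (metis inj_onI linorder_neqE_nat less_irrefl)
  then have "card (g ` A) = card (f ` A)"
    using card_image[of h "f ` A"] by (simp add: g_def image_comp)
  then have "g ` A = {1..card (f ` A)}" using range by (intro card_subset_eq) auto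
  moreover have "g \<in> A \<rightarrow>\<^sub>E {1..card (f ` A)}" using range by (auto simp: g_def)
  ultimately show ?thesis using that order by blast
qed

text \<open>Every variable occurs in \<open>t\<close> or \<open>s\<close>, so the smaller of the two
  values is the minimum of \<open>P\<close> over all variables; equality means that both sides
  attain it.\<close>

lemma value_at_eq_iff_common_minimum:
  assumes "(t, s) \<in> Eq n"
  shows "value_at P t = value_at P s \<longleftrightarrow>
    (\<exists>x y. x \<in># t \<and> y \<in># s \<and> P x = P y \<and> (\<forall>z \<in> {1..n}. P x \<le> P z))"
    (is "_ \<longleftrightarrow> ?R")
proof
  have ne: "t \<noteq> {#}" "s \<noteq> {#}" and U: "set_mset t \<union> set_mset s = {1..n}"
    using assms by (auto simp: Eq_def equations_def is_term_def)
  {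
    assume eq: "value_at P t = value_at P s"
    obtain x where x: "x \<in># t" "value_at P t = P x" "\<And>y. y \<in># t \<Longrightarrow> P x \<le> P y"
      using value_at_attained[OF ne(1)] by metis
    obtain y where y: "y \<in># s" "value_at P s = P y" "\<And>z. z \<in># s \<Longrightarrow> P y \<le> P z"
      using value_at_attained[OF ne(2)] by metis
    have "P x \<le> P z" if "z \<in> {1..n}" for z using that U x y eq by fastforce
    then show ?R using x y eq by metis
  next
    assume ?R
    then obtain x y where xy: "x \<in># t" "y \<in># s" "P x = P y" "\<forall>z \<in> {1..n}. P x \<le> P z" by blast
    have "value_at P t = P x" using xy U by (intro value_at_eqI) auto
    moreover have "value_at P s = P y" using xy U by (intro value_at_eqI) auto
    ultimately show "value_at P t = value_at P s" using xy(3) by simp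
  }
qed

lemma refine_solution:
  assumes ts: "(t, s) \<in> Eq n" and "l < n"
    and P: "P \<in> V l n {(t, s)}" and less: "card (P ` {1..n}) < l"
  obtains P' where "P' \<in> V l n {(t, s)}" "P \<in> point_closure l n P'"
    "card (P' ` {1..n}) = Suc (card (P ` {1..n}))"
proof -
  have U: "set_mset t \<union> set_mset s = {1..n}" using ts by (auto simp: Eq_def)
  have "value_at P t = value_at P s" using P by (simp add: V_def)
  then obtain x y where xy: "x \<in># t" "y \<in># s" "P x = P y" "\<forall>z \<in> {1..n}. P x \<le> P z"
    using value_at_eq_iff_common_minimum[OF ts] by blast
  \<comment> \<open>The variable \<open>a\<close> to be moved shares its value with
    \<open>b\<close>, so that no value is lost, and avoids \<open>x\<close> and \<open>y\<close>, so
    that both sides keep the minimum. Without such a pair \<open>P\<close> would be injective off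
    \<open>y\<close> and take at least \<open>n - 1 \<ge> l\<close> values.\<close>
  have "\<exists>a b. a \<in> {1..n} \<and> b \<in> {1..n} \<and> a \<noteq> b \<and> P a = P b \<and> a \<noteq> x \<and> a \<noteq> y"
  proof (rule ccontr)
    assume "\<not> ?thesis"
    then have "inj_on P ({1..n} - {y})" by (intro inj_onI) (metis DiffE insertCI)
    moreover have "y \<in> {1..n}" using xy(2) U by blast
    ultimately have "n - 1 = card (P ` ({1..n} - {y}))"
      by (simp add: card_image)
    also have "\<dots> \<le> card (P ` {1..n})" by (intro card_mono) auto
    finally show False using less \<open>l < n\<close> by simp
  qed
  then obtain a b where ab: "a \<in> {1..n}" "b \<in> {1..n}" "a \<noteq> b" "P a = P b" "a \<noteq> x" "a \<noteq> y"
    by blast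
  \<comment> \<open>Doubling makes room for a new value directly above the old value of
    \<open>a\<close>.\<close>
  define f where "f i = (if i = a then 2 * P i + 1 else 2 * P i)" for i
  have f_mono: "P i \<le> P j" if "f i \<le> f j" for i j
    using that by (auto simp: f_def split: if_splits)
  have "f ` {1..n} = insert (2 * P a + 1) ((\<lambda>v. 2 * v) ` P ` {1..n})"
  proof (intro equalityI subsetI)
    fix v assume "v \<in> insert (2 * P a + 1) ((\<lambda>v. 2 * v) ` P ` {1..n})"
    then consider "v = f a" | i where "i \<in> {1..n}" "v = 2 * P i" by (auto simp: f_def)
    then show "v \<in> f ` {1..n}"
    proof cases
      case 1
      then show ?thesis using ab(1) by blast
    next
      case 2
      \<comment> \<open>The value \<open>2 * P a\<close> is still attained, by
        \<open>b\<close>.\<close>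
      then have "v = f (if i = a then b else i)" using ab(3,4) by (simp add: f_def)
      then show ?thesis using 2(1) ab(2) by simp
    qed
  qed (auto simp: f_def)
  moreover have "2 * P a + 1 \<notin> (\<lambda>v. 2 * v) ` P ` {1..n}" by auto presburger
  ultimately have card_f: "card (f ` {1..n}) = Suc (card (P ` {1..n}))"
    by (simp add: card_image inj_on_def)
  obtain P' where P': "P' \<in> {1..n} \<rightarrow>\<^sub>E {1..card (f ` {1..n})}"
    "P' ` {1..n} = {1..card (f ` {1..n})}"
    "\<And>i j. i \<in> {1..n} \<Longrightarrow> j \<in> {1..n} \<Longrightarrow> P' i \<le> P' j \<longleftrightarrow> f i \<le> f j"
    using order_preserving_ranking[of "{1..n}" f] by auto
  have "{1..card (f ` {1..n})} \<subseteq> {1..l}" using card_f less by simp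
  then have pts: "P' \<in> points l n" using P'(1) unfolding points_def L_def by fastforce
  have xn: "x \<in> {1..n}" "y \<in> {1..n}" using xy U by auto
  have "f x = f y" "\<forall>z \<in> {1..n}. f x \<le> f z"
    using ab xy(3,4) by (auto simp: f_def intro: le_SucI)
  then have "P' x = P' y" "\<forall>z \<in> {1..n}. P' x \<le> P' z" using P'(3) xn by (auto intro: antisym)
  then have "value_at P' t = value_at P' s"
    using value_at_eq_iff_common_minimum[OF ts] xy(1,2) by blast
  then have "P' \<in> V l n {(t, s)}" using pts by (simp add: V_def)
  moreover have "P \<in> point_closure l n P'"
    using P P'(3) f_mono by (auto simp: point_closure_def V_def)
  moreover have "card (P' ` {1..n}) = Suc (card (P ` {1..n}))" using P'(2) card_f by simp
  ultimately show ?thesis using that by blast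
qed

text \<open>Each refinement gains one value, so the number of missing values drops until the
  solution is surjective.\<close>

lemma solution_in_surjective_closure:
  assumes "(t, s) \<in> Eq n" "l < n" "P \<in> V l n {(t, s)}"
  shows "\<exists>P' \<in> V l n {(t, s)} \<inter> surjections {1..n} (L l). P \<in> point_closure l n P'"
  using assms(3)
proof (induction "l - card (P ` {1..n})" arbitrary: P rule: less_induct)
  case less
  have sub: "P \<in> {1..n} \<rightarrow>\<^sub>E L l" using less.prems by (simp add: V_def points_def)
  then have im: "P ` {1..n} \<subseteq> L l" by blast
  show ?case
  proof (cases "card (P ` {1..n}) < l")
    case True
    then obtain P' where P': "P' \<in> V l n {(t, s)}" "P \<in> point_closure l n P'"
      "card (P' ` {1..n}) = Suc (card (P ` {1..n}))"
      using refine_solution[OF assms(1,2) less.prems] by metis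
    then have "l - card (P' ` {1..n}) < l - card (P ` {1..n})" using True by simp
    then obtain P'' where P'': "P'' \<in> V l n {(t, s)} \<inter> surjections {1..n} (L l)"
      "P' \<in> point_closure l n P''"
      using less.hyps P'(1) by blast
    \<comment> \<open>Closures are algebraic, so the closure of \<open>P'\<close> lies inside that
      of \<open>P''\<close>.\<close>
    then have "P \<in> point_closure l n P''"
      using P'(2) point_closure_subset[OF algebraic_point_closure] by blast
    then show ?thesis using P''(1) by blast
  next
    case False
    then have "P ` {1..n} = L l"
      using im by (intro card_seteq) (auto simp: L_def)
    then have "P \<in> surjections {1..n} (L l)" using sub by (simp add: surjections_def)
    moreover have "P \<in> point_closure l n P"
      using less.prems by (intro mem_point_closure_self) (simp add: V_def)
    ultimately show ?thesis using less.prems by blast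
  qed
qed

section \<open>The number of components\<close>

text \<open>Taking closures is a bijection from the surjective solutions to the components, since
  their closures form a decomposition and decompositions are unique.\<close>

lemma card_irreducible_components_equation:
  assumes ts: "(t, s) \<in> Eq n" and "l < n"
  shows "card (irreducible_components l n (V l n {(t, s)})) =
    card (V l n {(t, s)} \<inter> surjections {1..n} (L l))"
proof -
  let ?Y = "V l n {(t, s)}"
  let ?S = "?Y \<inter> surjections {1..n} (L l)"
  have alg: "algebraic l n ?Y"
    using ts unfolding algebraic_def Eq_def by (intro exI[of _ "{(t, s)}"]) auto
  have pts: "P \<in> points l n" if "P \<in> ?S" for P using that by (simp add: V_def)
  \<comment> \<open>This one fact yields both the absence of inclusions between distinct closures
    and the injectivity of \<open>point_closure l n\<close>.\<close>
  have eq: "P' = P" if "P \<in> ?S" "P' \<in> ?S" "point_closure l n P \<subseteq> point_closure l n P'" for P P'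
    using that surjection_mem_point_closure_imp_eq[of P n l P'] mem_point_closure_self pts by blast
  have "is_decomposition l n ?Y (point_closure l n ` ?S)"
    unfolding is_decomposition_def
  proof (intro conjI)
    show "finite (point_closure l n ` ?S)" using finite_algebraic[OF alg] by simp
    show "\<forall>Z\<in>point_closure l n ` ?S. irreducible_set l n Z"
      using pts irreducible_point_closure by blast
    show "?Y = \<Union> (point_closure l n ` ?S)"
      using solution_in_surjective_closure[OF assms] point_closure_subset[OF alg] by blast
    show "\<forall>Z\<in>point_closure l n ` ?S. \<forall>W\<in>point_closure l n ` ?S. Z \<noteq> W \<longrightarrow> \<not> Z \<subseteq> W"
      using eq by blast
  qed
  then have "irreducible_components l n ?Y = point_closure l n ` ?S"
    using irreducible_components_decomposition[OF alg] decomposition_ex1[OF alg] by blast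
  moreover have "inj_on (point_closure l n) ?S"
    using eq by (intro inj_onI) blast
  ultimately show ?thesis by (simp add: card_image)
qed

text \<open>The minimum of a surjective point is 1, so its fibre over 1 must meet both sides. As the
  two sides cover all variables, missing one side means lying in the difference that belongs to the
  other.\<close>

lemma surjection_solution_iff:
  assumes ts: "(t, s) \<in> Eq n" and "l \<ge> 1" and P: "P \<in> surjections {1..n} (L l)"
  shows "P \<in> V l n {(t, s)} \<longleftrightarrow>
    \<not> {x \<in> {1..n}. P x = 1} \<subseteq> set_mset t - set_mset s \<and>
    \<not> {x \<in> {1..n}. P x = 1} \<subseteq> set_mset s - set_mset t"
proof -
  have U: "set_mset t \<union> set_mset s = {1..n}" using ts by (auto simp: Eq_def)
  have im: "P ` {1..n} = {1..l}" using P by (auto simp: surjections_def L_def)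
  then obtain w where w: "w \<in> {1..n}" "P w = 1" using \<open>l \<ge> 1\<close>
    by (metis atLeastAtMost_iff imageE order_refl)
  have ge: "1 \<le> P z" if "z \<in> {1..n}" for z using that im by (metis atLeastAtMost_iff imageI)
  have min: "(\<forall>z \<in> {1..n}. P x \<le> P z) \<longleftrightarrow> P x = 1" if "x \<in> {1..n}" for x
    using w ge that by (metis antisym)
  have "P \<in> V l n {(t, s)} \<longleftrightarrow> value_at P t = value_at P s"
    using P by (auto simp: V_def surjections_def points_def)
  also have "\<dots> \<longleftrightarrow> (\<exists>x \<in> set_mset t. P x = 1) \<and> (\<exists>y \<in> set_mset s. P y = 1)"
    using value_at_eq_iff_common_minimum[OF ts] min U by (metis UnI1)
  also have "\<dots> \<longleftrightarrow> \<not> {x \<in> {1..n}. P x = 1} \<subseteq> set_mset t - set_mset s \<and>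
    \<not> {x \<in> {1..n}. P x = 1} \<subseteq> set_mset s - set_mset t"
    using U w by blast
  finally show ?thesis .
qed

theorem mainTheorem3:
  fixes l n k1 k2 :: nat and t s :: trm
  assumes "l \<ge> 1" and "n > l"
    and "k1 + k2 \<le> n"
    and "(k1, k2) \<notin> {(0, n), (n, 0)}"
    and "(t, s) \<in> Eq n"
    and "is_k_equation k1 k2 (t, s)"
  shows "int (card (irreducible_components l n (V l n {(t, s)}))) =
           int (Stirling_star n l)
           - (\<Sum>i=1..k1. int ((k1 choose i) * Stirling_star (n - i) (l - 1)))
           - (\<Sum>i=1..k2. int ((k2 choose i) * Stirling_star (n - i) (l - 1)))"
proof -
  let ?T = "set_mset t - set_mset s"
  let ?U = "set_mset s - set_mset t"
  let ?S = "surjections {1..n} (L l)"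
  let ?B = "\<lambda>D. {f \<in> ?S. {x \<in> {1..n}. f x = 1} \<subseteq> D}"
  have fin: "finite ?S" by (simp add: finite_surjections L_def)
  have k: "card ?T = k1" "card ?U = k2" using assms(6) by (auto simp: is_k_equation_def)
  have sub: "?T \<subseteq> {1..n}" "?U \<subseteq> {1..n}" using assms(5) by (auto simp: Eq_def)
  have one: "1 \<in> L l" using assms(1) by (simp add: L_def)
  have card_B: "card (?B D) = (\<Sum>i=1..card D. (card D choose i) * Stirling_star (n - i) (l - 1))"
    if "D \<subseteq> {1..n}" for D
    using card_surjections_fibre_subset[of "{1..n}" "L l" 1 D] that one by (simp add: L_def)
  \<comment> \<open>A fibre inside both differences would be empty, but the value 1 is
    attained.\<close>
  have "?B ?T \<inter> ?B ?U = {}"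
  proof (rule equals0I)
    fix f assume f: "f \<in> ?B ?T \<inter> ?B ?U"
    then have "1 \<in> f ` {1..n}" using one by (simp add: surjections_def)
    then obtain x where "x \<in> {x \<in> {1..n}. f x = 1}" by auto
    then show False using f by blast
  qed
  moreover have "?S - V l n {(t, s)} = ?B ?T \<union> ?B ?U"
    using surjection_solution_iff[OF assms(5,1)] by blast
  ultimately have "card (?S - V l n {(t, s)}) = card (?B ?T) + card (?B ?U)"
    using fin by (simp add: card_Un_disjoint)
  moreover have "card ?S = card (V l n {(t, s)} \<inter> ?S) + card (?S - V l n {(t, s)})"
    using fin by (metis card_Int_Diff inf_commute)
  moreover have "card ?S = Stirling_star n l" by (simp add: card_surjections L_def)
  \<comment> \<open>Stated additively over the naturals, so that subtraction takes place only among
    integers.\<close>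
  ultimately have "Stirling_star n l =
      card (irreducible_components l n (V l n {(t, s)})) + (card (?B ?T) + card (?B ?U))"
    using card_irreducible_components_equation[OF assms(5,2)] by simp
  then show ?thesis
    unfolding card_B[OF sub(1)] card_B[OF sub(2)] k by simp
qed

end
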